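(* Let $n\ge2$ and $\mathcal{W}=\mathcal{W}_{\lambda_-,\lambda_+}$ with $\lambda_-\le\lambda_+\in(-1,1)$. Consider a performance evaluation setting $\mathcal{S}_n=\{n,\mathcal{A},K,\mathcal{P},\mathcal{F},\mathcal{I},\mathcal{W}\}$ in which the algorithm $\mathcal{A}\in\mathcal{A}_d$, the performance measure $\mathcal{P}$, the initial conditions $\mathcal{I}$ and the interpolation constraints for $\mathcal{F}$ are linearly (or LMI) Gram-representable, and assume all the agents are equivalent in the PEP. Then: 1. The computation of $w(\mathcal{S}_n)$ can be formulated as an SDP with variables $f^A\in\mathbb{R}^q$, $G^A\in\mathbb{R}^{p\times p}$, $G^C\in\mathbb{R}^{p\times p}$, whose size is independent of $n$. 2. If, in addition, $\mathcal{P}$ is scale-invariant and $\mathcal{I}$ only contains single-agent constraints (each applied to every agent $i$) and scale-invariant constraints, then the resulting SDP and its optimal value $w(\mathcal{S}_n)$ are independent of $n$.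
   Context: Distributed optimization: $n$ agents with local functions $f_i:\mathbb{R}^d\to\mathbb{R}$ minimize $f(x)=\frac1n\sum_if_i(x)$. $\mathcal{A}_d$ is the class of algorithms built from (i) local gradient evaluations $g_i=\nabla f_i(x_i)$ at any local variable, (ii) consensus steps $\mathbf{y}=(W\otimes I_d)\mathbf{x}$ (i.e. $y_i=\sum_jw_{ij}x_j$) with $W\in\mathcal{W}$, (iii) linear combinations of an agent's local variables with coefficients known in advance. $\mathcal{W}_{\lambda_-,\lambda_+}$ is the set of symmetric $W\in\mathbb{R}^{n\times n}$ with $\lambda_1(W)=1$, eigenvector $\mathbf{1}/\sqrt n$, other eigenvalues in $[\lambda_-,\lambda_+]$. The setting $\mathcal{S}_n$ specifies $n$, the algorithm $\mathcal{A}$, the number of iterations $K$, the performance criterion $\mathcal{P}$, the class $\mathcal{F}$ of local functions, the initial conditions $\mathcal{I}$, and $\mathcal{W}$. Agent-dependent SDP PEP: each agent $i$ holds $p$ vector variables (iterates, consensus outputs, gradients at these points, and copies of points common to all agents such as the minimizer $x^*$ with $\nabla f_i(x^* )$), gathered as columns of $P_i\in\mathbb{R}^{d\times p}$ in a common order, and $q$ function values in $f_i\in\mathbb{R}^q$; variables $F=[f_1^T\dots f_n^T]$, $G=P^TP\succeq0$, $P=[P_1\dots P_n]$, $G_{ij}=P_i^TP_j$. An expression or constraint is linearly (resp. LMI) Gram-representable if it is given by finitely many linear (resp. linear matrix inequality) constraints or expressions in $(F,G)$. The PEP maximizes $\mathcal{P}(F,G)$ subject to $G\succeq0$, the algorithm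 constraints, interpolation constraints for $\mathcal{F}$ on each agent's triplets (point, gradient, value), the initial conditions, the optimality condition $\frac1n\sum_i\nabla f_i(x^* )=0$, and, for each set of consensus steps using a common matrix, with $X=[\mathbf{x}^1\dots\mathbf{x}^K]$, $Y=[\mathbf{y}^1\dots\mathbf{y}^K]\in\mathbb{R}^{nd\times K}$: $\bar X=\bar Y$, $(Y_\perp-\lambda_-X_\perp)^T(Y_\perp-\lambda_+X_\perp)\preceq0$, $X_\perp^TY_\perp=Y_\perp^TX_\perp$, where $\bar X$ replaces each agent's component by the agent average and $X_\perp=X-\bar X$. $w(\mathcal{S}_n)$ denotes the optimal value of this SDP. Agents $i,j$ are equivalent if for every feasible $(F,G)$, swapping the blocks of agents $i$ and $j$ gives a feasible solution with the same objective value. $f^A$, $G^A$, $G^C$ denote, respectively, the common agent block of function values, the common diagonal block, and the common off-diagonal block of a solution in which all $f_i$ are equal, all $G_{ii}$ are equal, and all $G_{ij}$ ($i\ne j$) are equal. A Gram-representable expression $h$ is scale-invariant if $h=\sum_jc_jh_j$ with coefficients $c_j$ independent of $n$ and each $h_j$ of one of the forms $\frac1n\sum_if_i(x_i)$, $\frac1n\sum_ix_i^Ty_i$, $\frac1{n^2}\sum_i\sum_jx_i^Ty_j$ for local variables $x_i,y_j$ of agents $i,j$ (common points being copied in each agent's variables); a constraint $h\le D$ is scale-invariant if $h$ is. An expression is single-agent if it is a linear combination, with coefficients independent of $n$, of terms involving only the local variables and local function of one agent $i$; a constraint $h\le D$ is single-agent if $h$ is. *)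

theory Defs
  imports Complex_Main "HOL-Library.Extended_Real" "HOL-Combinatorics.Transposition"
begin

text \<open>
  Agent i holds p vector variables (columns of P_i)
  and q function values.  Indices: agents i < n, vector columns a < p, values a < q.
    F i a        = a-th function value of agent i          (the block f_i of F)
    G i j a b    = (P_i^T P_j)_{ab}                         (the block G_ij of G = P^T P)
\<close>

type_synonym fvals = "nat \<Rightarrow> nat \<Rightarrow> real"
type_synonym gram = "nat \<Rightarrow> nat \<Rightarrow> nat \<Rightarrow> nat \<Rightarrow> real"

definition psd_mat :: "nat \<Rightarrow> (nat \<Rightarrow> nat \<Rightarrow> real) \<Rightarrow> bool" where
  "psd_mat m M \<longleftrightarrow> (\<forall>k<m. \<forall>l<m. M k l = M l k) \<and>
     (\<forall>v. 0 \<le> (\<Sum>k<m. \<Sum>l<m. v k * M k l * v l))"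

definition psd_gram :: "nat \<Rightarrow> nat \<Rightarrow> gram \<Rightarrow> bool" where
  "psd_gram n p G \<longleftrightarrow> (\<forall>i<n. \<forall>j<n. \<forall>a<p. \<forall>b<p. G i j a b = G j i b a) \<and>
     (\<forall>v. 0 \<le> (\<Sum>i<n. \<Sum>j<n. \<Sum>a<p. \<Sum>b<p. v i a * G i j a b * v j b))"

definition gram_affine :: "nat \<Rightarrow> nat \<Rightarrow> nat \<Rightarrow> (fvals \<Rightarrow> gram \<Rightarrow> real) \<Rightarrow> bool" where
  "gram_affine n p q h \<longleftrightarrow> (\<exists>c0 cF cG. \<forall>F G. h F G = c0 + (\<Sum>i<n. \<Sum>a<q. cF i a * F i a)
      + (\<Sum>i<n. \<Sum>j<n. \<Sum>a<p. \<Sum>b<p. cG i j a b * G i j a b))"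

text \<open>A constraint set given by finitely many LMIs whose entries are affine in (F,G)
  (linear inequalities/equalities are 1 x 1 LMIs).\<close>
definition lmi_representable :: "nat \<Rightarrow> nat \<Rightarrow> nat \<Rightarrow> (fvals \<Rightarrow> gram \<Rightarrow> bool) \<Rightarrow> bool" where
  "lmi_representable n p q C \<longleftrightarrow>
     (\<exists>cs :: (nat \<times> (nat \<Rightarrow> nat \<Rightarrow> fvals \<Rightarrow> gram \<Rightarrow> real)) list.
        (\<forall>(m, M) \<in> set cs. \<forall>k<m. \<forall>l<m. gram_affine n p q (M k l)) \<and>
        (\<forall>F G. C F G \<longleftrightarrow> (\<forall>(m, M) \<in> set cs. psd_mat m (\<lambda>k l. M k l F G))))"

record sa_expr =
  sa_c0 :: real
  sa_cf :: "nat \<Rightarrow> real"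
  sa_cg :: "nat \<Rightarrow> nat \<Rightarrow> real"

definition sa_eval :: "nat \<Rightarrow> nat \<Rightarrow> sa_expr \<Rightarrow> fvals \<Rightarrow> gram \<Rightarrow> nat \<Rightarrow> real" where
  "sa_eval p q e F G i = sa_c0 e + (\<Sum>a<q. sa_cf e a * F i a)
      + (\<Sum>a<p. \<Sum>b<p. sa_cg e a b * G i i a b)"

type_synonym sa_lmi = "nat \<times> (nat \<Rightarrow> nat \<Rightarrow> sa_expr)"

definition sa_holds :: "nat \<Rightarrow> nat \<Rightarrow> sa_lmi \<Rightarrow> fvals \<Rightarrow> gram \<Rightarrow> nat \<Rightarrow> bool" where
  "sa_holds p q c F G i \<longleftrightarrow> psd_mat (fst c) (\<lambda>k l. sa_eval p q (snd c k l) F G i)"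

definition avgF :: "nat \<Rightarrow> fvals \<Rightarrow> nat \<Rightarrow> real" where
  "avgF n F a = (\<Sum>i<n. F i a) / real n"

definition avgD :: "nat \<Rightarrow> gram \<Rightarrow> nat \<Rightarrow> nat \<Rightarrow> real" where
  "avgD n G a b = (\<Sum>i<n. G i i a b) / real n"

definition avg_inner :: "nat \<Rightarrow> gram \<Rightarrow> nat \<Rightarrow> nat \<Rightarrow> real" where
  "avg_inner n G a b = (\<Sum>i<n. \<Sum>j<n. G i j a b) / (real n)^2"

record si_expr =
  si_c0 :: real
  si_cf :: "nat \<Rightarrow> real"
  si_cA :: "nat \<Rightarrow> nat \<Rightarrow> real"
  si_cC :: "nat \<Rightarrow> nat \<Rightarrow> real"

definition si_eval :: "nat \<Rightarrow> nat \<Rightarrow> nat \<Rightarrow> si_expr \<Rightarrow> fvals \<Rightarrow> gram \<Rightarrow> real" where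
  "si_eval n p q e F G = si_c0 e + (\<Sum>a<q. si_cf e a * avgF n F a)
      + (\<Sum>a<p. \<Sum>b<p. si_cA e a b * avgD n G a b)
      + (\<Sum>a<p. \<Sum>b<p. si_cC e a b * avg_inner n G a b)"

type_synonym si_lmi = "nat \<times> (nat \<Rightarrow> nat \<Rightarrow> si_expr)"

definition si_holds :: "nat \<Rightarrow> nat \<Rightarrow> nat \<Rightarrow> si_lmi \<Rightarrow> fvals \<Rightarrow> gram \<Rightarrow> bool" where
  "si_holds n p q c F G \<longleftrightarrow> psd_mat (fst c) (\<lambda>k l. si_eval n p q (snd c k l) F G)"

text \<open>Consensus constraints.  A block (xs, ys) lists the columns of x^1..x^K and y^1..y^K.
  perpG a b = sum_i (u_i - ubar)^T (w_i - wbar) for columns a (u) and b (w).\<close>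
definition perpG :: "nat \<Rightarrow> gram \<Rightarrow> nat \<Rightarrow> nat \<Rightarrow> real" where
  "perpG n G a b = (\<Sum>i<n. G i i a b) - (\<Sum>i<n. \<Sum>j<n. G i j a b) / real n"

definition consensus_holds :: "nat \<Rightarrow> real \<Rightarrow> real \<Rightarrow> nat list \<times> nat list \<Rightarrow> gram \<Rightarrow> bool" where
  "consensus_holds n lm lp blk G \<longleftrightarrow>
     (let xs = fst blk; ys = snd blk; K = length xs in
       \<comment> \<open>Xbar = Ybar, i.e. ||xbar^k - ybar^k||^2 = 0\<close>
       (\<forall>k<K. avg_inner n G (xs!k) (xs!k) - 2 * avg_inner n G (xs!k) (ys!k)
              + avg_inner n G (ys!k) (ys!k) = 0) \<and>
       \<comment> \<open>X_perp^T Y_perp = Y_perp^T X_perp\<close>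
       (\<forall>k<K. \<forall>l<K. perpG n G (xs!k) (ys!l) = perpG n G (ys!k) (xs!l)) \<and>
       \<comment> \<open>(Y_perp - lm X_perp)^T (Y_perp - lp X_perp) \<preceq> 0\<close>
       psd_mat K (\<lambda>k l. - (perpG n G (ys!k) (ys!l) - lp * perpG n G (ys!k) (xs!l)
                          - lm * perpG n G (xs!k) (ys!l) + lm * lp * perpG n G (xs!k) (xs!l))))"

text \<open>The n-independent data of a setting: dimensions p, q; spectral bounds of W;
  single-agent constraints applied to every agent (algorithm's local linear steps and
  interpolation constraints of the class F on each agent's triplets); columns of points
  common to all agents (e.g. x^*); column of grad f_i(x^*); consensus blocks.\<close>
record pep_data =
  pd_p :: nat
  pd_q :: nat
  pd_lmin :: real
  pd_lmax :: real
  pd_local :: "sa_lmi list"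
  pd_common :: "nat list"
  pd_gopt :: nat
  pd_cons :: "(nat list \<times> nat list) list"

definition pep_wf :: "pep_data \<Rightarrow> bool" where
  "pep_wf D \<longleftrightarrow> (\<forall>c \<in> set (pd_common D). c < pd_p D) \<and> pd_gopt D < pd_p D \<and>
     (\<forall>blk \<in> set (pd_cons D). length (fst blk) = length (snd blk) \<and>
        (\<forall>c \<in> set (fst blk) \<union> set (snd blk). c < pd_p D))"

definition pep_feasible :: "nat \<Rightarrow> pep_data \<Rightarrow> (fvals \<Rightarrow> gram \<Rightarrow> bool) \<Rightarrow> fvals \<Rightarrow> gram \<Rightarrow> bool" where
  "pep_feasible n D Init F G \<longleftrightarrow>
     psd_gram n (pd_p D) G \<and>
     (\<forall>i<n. \<forall>c \<in> set (pd_local D). sa_holds (pd_p D) (pd_q D) c F G i) \<and>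
     (\<forall>c \<in> set (pd_common D). \<forall>i<n. \<forall>j<n. G i i c c - 2 * G i j c c + G j j c c = 0) \<and>
     avg_inner n G (pd_gopt D) (pd_gopt D) = 0 \<and>
     (\<forall>blk \<in> set (pd_cons D). consensus_holds n (pd_lmin D) (pd_lmax D) blk G) \<and>
     Init F G"

definition pep_value :: "nat \<Rightarrow> pep_data \<Rightarrow> (fvals \<Rightarrow> gram \<Rightarrow> bool) \<Rightarrow> (fvals \<Rightarrow> gram \<Rightarrow> real) \<Rightarrow> ereal" where
  "pep_value n D Init Perf =
     (SUP FG \<in> {(F, G). pep_feasible n D Init F G}. ereal (Perf (fst FG) (snd FG)))"

definition swapF :: "nat \<Rightarrow> nat \<Rightarrow> fvals \<Rightarrow> fvals" where
  "swapF i j F = (\<lambda>k. F (transpose i j k))"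

definition swapG :: "nat \<Rightarrow> nat \<Rightarrow> gram \<Rightarrow> gram" where
  "swapG i j G = (\<lambda>k l. G (transpose i j k) (transpose i j l))"

definition agents_equivalent :: "nat \<Rightarrow> pep_data \<Rightarrow> (fvals \<Rightarrow> gram \<Rightarrow> bool) \<Rightarrow> (fvals \<Rightarrow> gram \<Rightarrow> real) \<Rightarrow> bool" where
  "agents_equivalent n D Init Perf \<longleftrightarrow>
     (\<forall>i<n. \<forall>j<n. \<forall>F G. pep_feasible n D Init F G \<longrightarrow>
        pep_feasible n D Init (swapF i j F) (swapG i j G) \<and>
        Perf (swapF i j F) (swapG i j G) = Perf F G)"

definition symF :: "(nat \<Rightarrow> real) \<Rightarrow> fvals" where
  "symF fA = (\<lambda>i. fA)"

definition symG :: "(nat \<Rightarrow> nat \<Rightarrow> real) \<Rightarrow> (nat \<Rightarrow> nat \<Rightarrow> real) \<Rightarrow> gram" where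
  "symG GA GC = (\<lambda>i j. if i = j then GA else GC)"

definition reduced_value :: "nat \<Rightarrow> pep_data \<Rightarrow> (fvals \<Rightarrow> gram \<Rightarrow> bool) \<Rightarrow> (fvals \<Rightarrow> gram \<Rightarrow> real) \<Rightarrow> ereal" where
  "reduced_value n D Init Perf =
     (SUP X \<in> {(fA, GA, GC). pep_feasible n D Init (symF fA) (symG GA GC)}.
        ereal (Perf (symF (fst X)) (symG (fst (snd X)) (snd (snd X)))))"

text \<open>Feasible set of the reduced SDP expressed in the variables
  (f^A, G^A, (G^A + (n-1) G^C)/n), the latter being the Gram block of the agent average.\<close>
definition reduced_set :: "nat \<Rightarrow> pep_data \<Rightarrow> (fvals \<Rightarrow> gram \<Rightarrow> bool)
     \<Rightarrow> ((nat \<Rightarrow> real) \<times> (nat \<Rightarrow> nat \<Rightarrow> real) \<times> (nat \<Rightarrow> nat \<Rightarrow> real)) set" where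
  "reduced_set n D Init =
     {(fA, GA, (\<lambda>a b. (GA a b + (real n - 1) * GC a b) / real n)) | fA GA GC.
        pep_feasible n D Init (symF fA) (symG GA GC)}"

end

theory Submission
  imports Defs "HOL-Combinatorics.Permutations"
begin

text \<open>
  The PEP is a convex problem: its constraints are LMIs in (F, G) and its objective is affine.
  If all agents are equivalent, feasibility and objective are invariant under every permutation
  of the agents, since transpositions generate the symmetric group.  Averaging a feasible point
  over all permutations thus gives a feasible point with the same objective in which all f_i,
  all G_ii and all G_ij (i \<noteq> j) coincide, so the supremum may be taken over such symmetric
  points (f^A, G^A, G^C).  For them, G \<succeq> 0 splits along the consensus direction and its
  orthogonal complement into G^A - G^C \<succeq> 0 and G^A + (n - 1) G^C \<succeq> 0.

  Pass to G^M = (G^A + (n - 1) G^C) / n, the Gram block of the agent average.  Agent averages of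
  local quantities become entries of f^A, G^A and G^M, and the consensus quantities
  X_perp^T Y_perp become n (G^A - G^M).  Every constraint of a scale-invariant setting is
  therefore, up to positive factors, an LMI in (f^A, G^A, G^M) alone, and n disappears.
\<close>

section \<open>Convexity of the PEP\<close>

definition mixF :: "(nat \<Rightarrow> nat) set \<Rightarrow> ((nat \<Rightarrow> nat) \<Rightarrow> real) \<Rightarrow> ((nat \<Rightarrow> nat) \<Rightarrow> fvals) \<Rightarrow> fvals" where
  "mixF S w Fs = (\<lambda>i a. \<Sum>s\<in>S. w s * Fs s i a)"

definition mixG :: "(nat \<Rightarrow> nat) set \<Rightarrow> ((nat \<Rightarrow> nat) \<Rightarrow> real) \<Rightarrow> ((nat \<Rightarrow> nat) \<Rightarrow> gram) \<Rightarrow> gram" where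
  "mixG S w Gs = (\<lambda>i j a b. \<Sum>s\<in>S. w s * Gs s i j a b)"

definition agree_on_agents :: "nat \<Rightarrow> fvals \<Rightarrow> gram \<Rightarrow> fvals \<Rightarrow> gram \<Rightarrow> bool" where
  "agree_on_agents m F G F' G' \<longleftrightarrow> (\<forall>i<m. F i = F' i) \<and> (\<forall>i<m. \<forall>j<m. G i j = G' i j)"

text \<open>Points (F, G) are total functions of the agent indices, but only the agents below m are
  meaningful; the locality clause of the next two notions records that a functional or constraint
  cannot see the others.\<close>

definition local_affine :: "nat \<Rightarrow> (fvals \<Rightarrow> gram \<Rightarrow> real) \<Rightarrow> bool" where
  "local_affine m h \<longleftrightarrow>
     (\<forall>S w Fs Gs. finite S \<longrightarrow> sum w S = 1 \<longrightarrow>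
        h (mixF S w Fs) (mixG S w Gs) = (\<Sum>s\<in>S. w s * h (Fs s) (Gs s))) \<and>
     (\<forall>F G F' G'. agree_on_agents m F G F' G' \<longrightarrow> h F G = h F' G')"

definition local_convex :: "nat \<Rightarrow> (fvals \<Rightarrow> gram \<Rightarrow> bool) \<Rightarrow> bool" where
  "local_convex m P \<longleftrightarrow>
     (\<forall>S w Fs Gs. finite S \<longrightarrow> (\<forall>s\<in>S. 0 \<le> w s) \<longrightarrow> sum w S = 1 \<longrightarrow>
        (\<forall>s\<in>S. P (Fs s) (Gs s)) \<longrightarrow> P (mixF S w Fs) (mixG S w Gs)) \<and>
     (\<forall>F G F' G'. agree_on_agents m F G F' G' \<longrightarrow> P F G = P F' G')"

lemma local_affine_mix:
  "local_affine m h \<Longrightarrow> finite S \<Longrightarrow> sum w S = 1 \<Longrightarrow>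
    h (mixF S w Fs) (mixG S w Gs) = (\<Sum>s\<in>S. w s * h (Fs s) (Gs s))"
  unfolding local_affine_def by simp

lemma local_affine_agree:
  "local_affine m h \<Longrightarrow> agree_on_agents m F G F' G' \<Longrightarrow> h F G = h F' G'"
  unfolding local_affine_def by blast

lemma local_convex_mix:
  "local_convex m P \<Longrightarrow> finite S \<Longrightarrow> (\<And>s. s \<in> S \<Longrightarrow> 0 \<le> w s) \<Longrightarrow> sum w S = 1 \<Longrightarrow>
    (\<And>s. s \<in> S \<Longrightarrow> P (Fs s) (Gs s)) \<Longrightarrow> P (mixF S w Fs) (mixG S w Gs)"
  unfolding local_convex_def by simp

lemma local_convex_agree:
  "local_convex m P \<Longrightarrow> agree_on_agents m F G F' G' \<Longrightarrow> P F G = P F' G'"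
  unfolding local_convex_def by blast

lemma local_affine_const: "local_affine m (\<lambda>F G. c)"
  unfolding local_affine_def by (simp add: sum_distrib_right[symmetric])

lemma local_affine_add:
  "local_affine m h1 \<Longrightarrow> local_affine m h2 \<Longrightarrow> local_affine m (\<lambda>F G. h1 F G + h2 F G)"
  unfolding local_affine_def by (simp add: distrib_left sum.distrib)

lemma local_affine_diff:
  "local_affine m h1 \<Longrightarrow> local_affine m h2 \<Longrightarrow> local_affine m (\<lambda>F G. h1 F G - h2 F G)"
  unfolding local_affine_def by (simp add: right_diff_distrib sum_subtractf)

lemma local_affine_uminus: "local_affine m h \<Longrightarrow> local_affine m (\<lambda>F G. - h F G)"
  unfolding local_affine_def by (simp add: sum_negf)

lemma local_affine_scale: "local_affine m h \<Longrightarrow> local_affine m (\<lambda>F G. c * h F G)"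
  unfolding local_affine_def by (simp add: sum_distrib_left mult.left_commute)

lemma local_affine_divide: "local_affine m h \<Longrightarrow> local_affine m (\<lambda>F G. h F G / c)"
  unfolding local_affine_def by (simp add: sum_divide_distrib)

lemma local_affine_sum:
  assumes "finite K" "\<And>k. k \<in> K \<Longrightarrow> local_affine m (h k)"
  shows "local_affine m (\<lambda>F G. \<Sum>k\<in>K. h k F G)"
  unfolding local_affine_def
proof (intro conjI allI impI)
  fix S :: "(nat \<Rightarrow> nat) set" and w :: "(nat \<Rightarrow> nat) \<Rightarrow> real" and Fs Gs
  assume "finite S" "sum w S = 1"
  then have "(\<Sum>k\<in>K. h k (mixF S w Fs) (mixG S w Gs)) = (\<Sum>k\<in>K. \<Sum>s\<in>S. w s * h k (Fs s) (Gs s))"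
    using assms(2) by (intro sum.cong refl local_affine_mix)
  also have "\<dots> = (\<Sum>s\<in>S. w s * (\<Sum>k\<in>K. h k (Fs s) (Gs s)))"
    unfolding sum_distrib_left by (rule sum.swap)
  finally show "(\<Sum>k\<in>K. h k (mixF S w Fs) (mixG S w Gs)) = (\<Sum>s\<in>S. w s * (\<Sum>k\<in>K. h k (Fs s) (Gs s)))" .
next
  fix F G F' G' assume agree: "agree_on_agents m F G F' G'"
  show "(\<Sum>k\<in>K. h k F G) = (\<Sum>k\<in>K. h k F' G')"
  proof (rule sum.cong[OF refl])
    fix k assume "k \<in> K"
    show "h k F G = h k F' G'" by (rule local_affine_agree[OF assms(2)[OF \<open>k \<in> K\<close>] agree])
  qed
qed

lemma local_affine_F: "i < m \<Longrightarrow> local_affine m (\<lambda>F G. F i a)"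
  unfolding local_affine_def agree_on_agents_def mixF_def by simp

lemma local_affine_G: "i < m \<Longrightarrow> j < m \<Longrightarrow> local_affine m (\<lambda>F G. G i j a b)"
  unfolding local_affine_def agree_on_agents_def mixG_def by simp

lemmas local_affine_intros = local_affine_const local_affine_add local_affine_diff
  local_affine_uminus local_affine_scale local_affine_divide
  local_affine_sum[OF finite_lessThan] local_affine_F local_affine_G

lemma local_convex_cong: "local_convex m P \<Longrightarrow> (\<And>F G. P' F G \<longleftrightarrow> P F G) \<Longrightarrow> local_convex m P'"
  by (subgoal_tac "P' = P") auto

lemma local_convex_eq:
  "local_affine m h1 \<Longrightarrow> local_affine m h2 \<Longrightarrow> local_convex m (\<lambda>F G. h1 F G = h2 F G)"
  unfolding local_convex_def by (simp add: local_affine_mix local_affine_agree)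

lemma local_convex_conj:
  assumes "local_convex m P" "local_convex m Q"
  shows "local_convex m (\<lambda>F G. P F G \<and> Q F G)"
  unfolding local_convex_def
proof (intro conjI allI impI)
  fix S :: "(nat \<Rightarrow> nat) set" and w :: "(nat \<Rightarrow> nat) \<Rightarrow> real" and Fs Gs
  assume "finite S" "\<forall>s\<in>S. 0 \<le> w s" "sum w S = 1" "\<forall>s\<in>S. P (Fs s) (Gs s) \<and> Q (Fs s) (Gs s)"
  then show "P (mixF S w Fs) (mixG S w Gs)" "Q (mixF S w Fs) (mixG S w Gs)"
    using local_convex_mix[OF assms(1)] local_convex_mix[OF assms(2)] by auto
next
  fix F G F' G' assume agree: "agree_on_agents m F G F' G'"
  show "(P F G \<and> Q F G) = (P F' G' \<and> Q F' G')"
    using local_convex_agree[OF assms(1) agree] local_convex_agree[OF assms(2) agree] by simp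
qed

lemma local_convex_all:
  assumes "\<And>x. local_convex m (P x)"
  shows "local_convex m (\<lambda>F G. \<forall>x. P x F G)"
  unfolding local_convex_def
proof (intro conjI allI impI)
  fix S :: "(nat \<Rightarrow> nat) set" and w :: "(nat \<Rightarrow> nat) \<Rightarrow> real" and Fs Gs x
  assume "finite S" "\<forall>s\<in>S. 0 \<le> w s" "sum w S = 1" "\<forall>s\<in>S. \<forall>x. P x (Fs s) (Gs s)"
  then show "P x (mixF S w Fs) (mixG S w Gs)"
    using local_convex_mix[OF assms] by auto
next
  fix F G F' G' assume agree: "agree_on_agents m F G F' G'"
  show "(\<forall>x. P x F G) = (\<forall>x. P x F' G')"
    using local_convex_agree[OF assms agree] by simp
qed

lemma local_convex_imp:
  "(Q \<Longrightarrow> local_convex m P) \<Longrightarrow> local_convex m (\<lambda>F G. Q \<longrightarrow> P F G)"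
  unfolding local_convex_def by (cases Q) simp_all

lemma local_convex_ball:
  "(\<And>x. x \<in> A \<Longrightarrow> local_convex m (P x)) \<Longrightarrow> local_convex m (\<lambda>F G. \<forall>x\<in>A. P x F G)"
  unfolding Ball_def by (intro local_convex_all local_convex_imp)

lemma sum_swap_innermost2:
  "(\<Sum>k\<in>A. \<Sum>l\<in>B. \<Sum>s\<in>S. f k l s) = (\<Sum>s\<in>S. \<Sum>k\<in>A. \<Sum>l\<in>B. f k l s)"
proof -
  have "(\<Sum>k\<in>A. \<Sum>l\<in>B. \<Sum>s\<in>S. f k l s) = (\<Sum>k\<in>A. \<Sum>s\<in>S. \<Sum>l\<in>B. f k l s)"
    by (rule sum.cong[OF refl], rule sum.swap)
  also have "\<dots> = (\<Sum>s\<in>S. \<Sum>k\<in>A. \<Sum>l\<in>B. f k l s)"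
    by (rule sum.swap)
  finally show ?thesis .
qed

lemma sum_swap_innermost4:
  "(\<Sum>i\<in>I. \<Sum>j\<in>J. \<Sum>k\<in>A. \<Sum>l\<in>B. \<Sum>s\<in>S. f i j k l s)
    = (\<Sum>s\<in>S. \<Sum>i\<in>I. \<Sum>j\<in>J. \<Sum>k\<in>A. \<Sum>l\<in>B. f i j k l s)"
proof -
  have "(\<Sum>i\<in>I. \<Sum>j\<in>J. \<Sum>k\<in>A. \<Sum>l\<in>B. \<Sum>s\<in>S. f i j k l s)
      = (\<Sum>i\<in>I. \<Sum>j\<in>J. \<Sum>s\<in>S. \<Sum>k\<in>A. \<Sum>l\<in>B. f i j k l s)"
    by (rule sum.cong[OF refl], rule sum.cong[OF refl], rule sum_swap_innermost2)
  also have "\<dots> = (\<Sum>s\<in>S. \<Sum>i\<in>I. \<Sum>j\<in>J. \<Sum>k\<in>A. \<Sum>l\<in>B. f i j k l s)"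
    by (rule sum_swap_innermost2)
  finally show ?thesis .
qed

lemma mult_sum_mult: "(x::real) * (\<Sum>s\<in>S. w s * g s) * y = (\<Sum>s\<in>S. w s * (x * g s * y))"
  by (simp add: sum_distrib_left sum_distrib_right mult_ac)

lemma psd_mat_cong:
  "(\<And>k l. k < K \<Longrightarrow> l < K \<Longrightarrow> M k l = M' k l) \<Longrightarrow> psd_mat K M = psd_mat K M'"
proof -
  assume eq: "\<And>k l. k < K \<Longrightarrow> l < K \<Longrightarrow> M k l = M' k l"
  then have "(\<Sum>k<K. \<Sum>l<K. v k * M k l * v l) = (\<Sum>k<K. \<Sum>l<K. v k * M' k l * v l)" for v
    by (intro sum.cong refl) auto
  with eq show ?thesis unfolding psd_mat_def by auto
qed

lemma psd_mat_scale_iff: "(c::real) > 0 \<Longrightarrow> psd_mat K (\<lambda>k l. c * M k l) \<longleftrightarrow> psd_mat K M"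
  unfolding psd_mat_def by (simp add: sum_distrib_left[symmetric] mult_ac zero_le_mult_iff)

lemma psd_mat_mix:
  assumes "finite S" "\<And>s. s \<in> S \<Longrightarrow> 0 \<le> w s" "\<And>s. s \<in> S \<Longrightarrow> psd_mat K (Ms s)"
  shows "psd_mat K (\<lambda>k l. \<Sum>s\<in>S. w s * Ms s k l)"
  unfolding psd_mat_def
proof (intro conjI allI impI)
  fix k l assume "k < K" "l < K"
  then show "(\<Sum>s\<in>S. w s * Ms s k l) = (\<Sum>s\<in>S. w s * Ms s l k)"
    using assms(3) unfolding psd_mat_def by (intro sum.cong refl) auto
next
  fix v :: "nat \<Rightarrow> real"
  have "(\<Sum>k<K. \<Sum>l<K. v k * (\<Sum>s\<in>S. w s * Ms s k l) * v l)
      = (\<Sum>s\<in>S. w s * (\<Sum>k<K. \<Sum>l<K. v k * Ms s k l * v l))"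
    unfolding mult_sum_mult unfolding sum_distrib_left by (rule sum_swap_innermost2)
  also have "\<dots> \<ge> 0"
    using assms unfolding psd_mat_def by (auto intro!: sum_nonneg)
  finally show "0 \<le> (\<Sum>k<K. \<Sum>l<K. v k * (\<Sum>s\<in>S. w s * Ms s k l) * v l)" .
qed

lemma local_convex_psd_mat:
  assumes "\<And>k l. k < K \<Longrightarrow> l < K \<Longrightarrow> local_affine m (M k l)"
  shows "local_convex m (\<lambda>F G. psd_mat K (\<lambda>k l. M k l F G))"
  unfolding local_convex_def
proof (intro conjI allI impI)
  fix S :: "(nat \<Rightarrow> nat) set" and w :: "(nat \<Rightarrow> nat) \<Rightarrow> real" and Fs Gs
  assume S: "finite S" "\<forall>s\<in>S. 0 \<le> w s" "sum w S = 1" "\<forall>s\<in>S. psd_mat K (\<lambda>k l. M k l (Fs s) (Gs s))"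
  have "psd_mat K (\<lambda>k l. \<Sum>s\<in>S. w s * M k l (Fs s) (Gs s))"
    using S by (intro psd_mat_mix) auto
  then show "psd_mat K (\<lambda>k l. M k l (mixF S w Fs) (mixG S w Gs))"
    using S(1,3) by (subst psd_mat_cong) (auto simp: local_affine_mix[OF assms])
next
  fix F G F' G' assume agree: "agree_on_agents m F G F' G'"
  show "psd_mat K (\<lambda>k l. M k l F G) = psd_mat K (\<lambda>k l. M k l F' G')"
    by (rule psd_mat_cong) (rule local_affine_agree[OF assms agree])
qed

lemma local_convex_psd_gram: "local_convex m (\<lambda>F G. psd_gram m p G)"
  unfolding local_convex_def
proof (intro conjI allI impI)
  fix S :: "(nat \<Rightarrow> nat) set" and w :: "(nat \<Rightarrow> nat) \<Rightarrow> real" and Fs Gs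
  assume S: "finite S" "\<forall>s\<in>S. 0 \<le> w s" "sum w S = 1" "\<forall>s\<in>S. psd_gram m p (Gs s)"
  show "psd_gram m p (mixG S w Gs)"
    unfolding psd_gram_def
  proof (intro conjI allI impI)
    fix i j a b assume "i < m" "j < m" "a < p" "b < p"
    then show "mixG S w Gs i j a b = mixG S w Gs j i b a"
      using S unfolding psd_gram_def mixG_def by (auto intro: sum.cong)
  next
    fix v :: "nat \<Rightarrow> nat \<Rightarrow> real"
    have "(\<Sum>i<m. \<Sum>j<m. \<Sum>a<p. \<Sum>b<p. v i a * mixG S w Gs i j a b * v j b)
       = (\<Sum>s\<in>S. w s * (\<Sum>i<m. \<Sum>j<m. \<Sum>a<p. \<Sum>b<p. v i a * Gs s i j a b * v j b))"
      unfolding mixG_def mult_sum_mult unfolding sum_distrib_left by (rule sum_swap_innermost4)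
    also have "\<dots> \<ge> 0"
      using S unfolding psd_gram_def by (auto intro!: sum_nonneg)
    finally show "0 \<le> (\<Sum>i<m. \<Sum>j<m. \<Sum>a<p. \<Sum>b<p. v i a * mixG S w Gs i j a b * v j b)" .
  qed
next
  fix F G F' G' assume "agree_on_agents m F G F' G'"
  then have "\<forall>i<m. \<forall>j<m. G i j = G' i j" unfolding agree_on_agents_def by blast
  then have "(\<Sum>i<m. \<Sum>j<m. \<Sum>a<p. \<Sum>b<p. v i a * G i j a b * v j b)
      = (\<Sum>i<m. \<Sum>j<m. \<Sum>a<p. \<Sum>b<p. v i a * G' i j a b * v j b)" for v
    by (intro sum.cong refl) auto
  with \<open>\<forall>i<m. \<forall>j<m. G i j = G' i j\<close> show "psd_gram m p G = psd_gram m p G'"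
    unfolding psd_gram_def by auto
qed

lemma local_affine_sa_eval: "i < m \<Longrightarrow> local_affine m (\<lambda>F G. sa_eval p q e F G i)"
  unfolding sa_eval_def by (intro local_affine_intros; simp)

lemma local_affine_avgF: "local_affine m (\<lambda>F G. avgF m F a)"
  unfolding avgF_def by (intro local_affine_intros; simp)

lemma local_affine_avgD: "local_affine m (\<lambda>F G. avgD m G a b)"
  unfolding avgD_def by (intro local_affine_intros; simp)

lemma local_affine_avg_inner: "local_affine m (\<lambda>F G. avg_inner m G a b)"
  unfolding avg_inner_def by (intro local_affine_intros; simp)

lemma local_affine_perpG: "local_affine m (\<lambda>F G. perpG m G a b)"
  unfolding perpG_def by (intro local_affine_intros; simp)

lemma local_affine_si_eval: "local_affine m (\<lambda>F G. si_eval m p q e F G)"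
  unfolding si_eval_def
  by (intro local_affine_intros local_affine_avgF local_affine_avgD local_affine_avg_inner; simp)

lemma local_affine_gram_affine:
  assumes "gram_affine n p q h"
  shows "local_affine n h"
proof -
  obtain c0 cF cG where "\<And>F G. h F G = c0 + (\<Sum>i<n. \<Sum>a<q. cF i a * F i a)
      + (\<Sum>i<n. \<Sum>j<n. \<Sum>a<p. \<Sum>b<p. cG i j a b * G i j a b)"
    using assms unfolding gram_affine_def by blast
  then have "h = (\<lambda>F G. c0 + (\<Sum>i<n. \<Sum>a<q. cF i a * F i a)
      + (\<Sum>i<n. \<Sum>j<n. \<Sum>a<p. \<Sum>b<p. cG i j a b * G i j a b))"
    by (intro ext)
  moreover have "local_affine n (\<lambda>F G. c0 + (\<Sum>i<n. \<Sum>a<q. cF i a * F i a)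
      + (\<Sum>i<n. \<Sum>j<n. \<Sum>a<p. \<Sum>b<p. cG i j a b * G i j a b))"
    by (intro local_affine_intros; simp)
  ultimately show ?thesis by simp
qed

lemma local_convex_sa_holds: "i < m \<Longrightarrow> local_convex m (\<lambda>F G. sa_holds p q c F G i)"
  unfolding sa_holds_def by (intro local_convex_psd_mat local_affine_sa_eval)

lemma local_convex_si_holds: "local_convex m (\<lambda>F G. si_holds m p q c F G)"
  unfolding si_holds_def by (intro local_convex_psd_mat local_affine_si_eval)

lemma local_convex_consensus_holds: "local_convex m (\<lambda>F G. consensus_holds m lm lp blk G)"
  unfolding consensus_holds_def Let_def
  by (intro local_convex_conj local_convex_all local_convex_imp local_convex_eq
      local_convex_psd_mat local_affine_intros local_affine_avg_inner local_affine_perpG)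

lemma local_convex_pep_feasible:
  "local_convex m Init \<Longrightarrow> local_convex m (pep_feasible m D Init)"
  unfolding pep_feasible_def
  by (intro local_convex_conj local_convex_psd_gram local_convex_all local_convex_imp
      local_convex_ball local_convex_sa_holds local_convex_eq local_affine_intros
      local_affine_avg_inner local_convex_consensus_holds)

lemma local_convex_lmi_representable:
  assumes "lmi_representable n p q Init"
  shows "local_convex n Init"
proof -
  obtain cs :: "(nat \<times> (nat \<Rightarrow> nat \<Rightarrow> fvals \<Rightarrow> gram \<Rightarrow> real)) list" where
    affine: "\<forall>(K, M) \<in> set cs. \<forall>k<K. \<forall>l<K. gram_affine n p q (M k l)" and
    Init: "\<And>F G. Init F G \<longleftrightarrow> (\<forall>(K, M) \<in> set cs. psd_mat K (\<lambda>k l. M k l F G))"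
    using assms unfolding lmi_representable_def by blast
  have "local_convex n (\<lambda>F G. \<forall>c\<in>set cs. psd_mat (fst c) (\<lambda>k l. snd c k l F G))"
  proof (intro local_convex_ball local_convex_psd_mat local_affine_gram_affine)
    fix c k l assume "c \<in> set cs" "k < fst c" "l < fst c"
    then show "gram_affine n p q (snd c k l)" using affine by fastforce
  qed
  then show ?thesis
    by (rule local_convex_cong) (simp add: Init case_prod_beta)
qed

section \<open>Permutations of the agents\<close>

definition permF :: "(nat \<Rightarrow> nat) \<Rightarrow> fvals \<Rightarrow> fvals" where
  "permF \<sigma> F = (\<lambda>i. F (\<sigma> i))"

definition permG :: "(nat \<Rightarrow> nat) \<Rightarrow> gram \<Rightarrow> gram" where
  "permG \<sigma> G = (\<lambda>i j. G (\<sigma> i) (\<sigma> j))"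

lemma sum_permutes_lessThan: "\<sigma> permutes {..<m} \<Longrightarrow> (\<Sum>i<m. f (\<sigma> i)) = (\<Sum>i<m. f i)"
  using sum.permute[of \<sigma> "{..<m}" f] by (simp add: o_def)

lemma sum_sum_permutes_lessThan:
  assumes "\<sigma> permutes {..<m}"
  shows "(\<Sum>i<m. \<Sum>j<m. f (\<sigma> i) (\<sigma> j)) = (\<Sum>i<m. \<Sum>j<m. f i j)"
  using sum_permutes_lessThan[OF assms, of "\<lambda>i. \<Sum>j<m. f i (\<sigma> j)"]
    sum_permutes_lessThan[OF assms, of "f _"]
  by simp

lemma psd_gram_permG:
  assumes \<sigma>: "\<sigma> permutes {..<m}" and G: "psd_gram m p G"
  shows "psd_gram m p (permG \<sigma> G)"
  unfolding psd_gram_def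
proof (intro conjI allI impI)
  fix i j a b assume "i < m" "j < m" "a < p" "b < p"
  then show "permG \<sigma> G i j a b = permG \<sigma> G j i b a"
    using G permutes_in_image[OF \<sigma>] unfolding psd_gram_def permG_def by auto
next
  fix v :: "nat \<Rightarrow> nat \<Rightarrow> real"
  define u where "u = v \<circ> inv \<sigma>"
  have v: "v i = u (\<sigma> i)" for i
    unfolding u_def using permutes_inverses(2)[OF \<sigma>] by simp
  have "0 \<le> (\<Sum>i<m. \<Sum>j<m. \<Sum>a<p. \<Sum>b<p. u i a * G i j a b * u j b)"
    using G unfolding psd_gram_def by blast
  also have "\<dots> = (\<Sum>i<m. \<Sum>j<m. \<Sum>a<p. \<Sum>b<p. v i a * permG \<sigma> G i j a b * v j b)"
    unfolding v permG_def
    by (rule sum_sum_permutes_lessThan[OF \<sigma>, symmetric])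
  finally show "0 \<le> (\<Sum>i<m. \<Sum>j<m. \<Sum>a<p. \<Sum>b<p. v i a * permG \<sigma> G i j a b * v j b)" .
qed

lemma sa_holds_permute: "sa_holds p q c (permF \<sigma> F) (permG \<sigma> G) i = sa_holds p q c F G (\<sigma> i)"
  by (simp add: sa_holds_def sa_eval_def permF_def permG_def)

lemma avgF_permF: "\<sigma> permutes {..<m} \<Longrightarrow> avgF m (permF \<sigma> F) a = avgF m F a"
  unfolding avgF_def permF_def by (simp add: sum_permutes_lessThan[where f = "\<lambda>i. F i a"])

lemma avgD_permG: "\<sigma> permutes {..<m} \<Longrightarrow> avgD m (permG \<sigma> G) a b = avgD m G a b"
  unfolding avgD_def permG_def by (simp add: sum_permutes_lessThan[where f = "\<lambda>i. G i i a b"])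

lemma avg_inner_permG: "\<sigma> permutes {..<m} \<Longrightarrow> avg_inner m (permG \<sigma> G) a b = avg_inner m G a b"
  unfolding avg_inner_def permG_def
  by (simp add: sum_sum_permutes_lessThan[where f = "\<lambda>i j. G i j a b"])

lemma perpG_permG: "\<sigma> permutes {..<m} \<Longrightarrow> perpG m (permG \<sigma> G) a b = perpG m G a b"
  unfolding perpG_def permG_def
  by (simp add: sum_sum_permutes_lessThan[where f = "\<lambda>i j. G i j a b"]
      sum_permutes_lessThan[where f = "\<lambda>i. G i i a b"])

lemma consensus_holds_permG:
  "\<sigma> permutes {..<m} \<Longrightarrow> consensus_holds m lm lp blk (permG \<sigma> G) = consensus_holds m lm lp blk G"
  unfolding consensus_holds_def Let_def by (simp add: avg_inner_permG perpG_permG)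

lemma si_eval_permute:
  "\<sigma> permutes {..<m} \<Longrightarrow> si_eval m p q e (permF \<sigma> F) (permG \<sigma> G) = si_eval m p q e F G"
  unfolding si_eval_def by (simp add: avg_inner_permG avgF_permF avgD_permG)

lemma si_holds_permute:
  "\<sigma> permutes {..<m} \<Longrightarrow> si_holds m p q c (permF \<sigma> F) (permG \<sigma> G) = si_holds m p q c F G"
  unfolding si_holds_def by (simp add: si_eval_permute)

lemma pep_feasible_permute:
  assumes \<sigma>: "\<sigma> permutes {..<m}"
    and Init: "\<And>F G. Init F G \<Longrightarrow> Init (permF \<sigma> F) (permG \<sigma> G)"
    and feasible: "pep_feasible m D Init F G"
  shows "pep_feasible m D Init (permF \<sigma> F) (permG \<sigma> G)"
proof -
  have "\<sigma> i < m" if "i < m" for i using permutes_in_image[OF \<sigma>] that by simp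
  then show ?thesis
    using feasible unfolding pep_feasible_def
    by (simp add: psd_gram_permG[OF \<sigma>] sa_holds_permute avg_inner_permG[OF \<sigma>]
        consensus_holds_permG[OF \<sigma>] Init) (simp add: permG_def)
qed

definition permutation_invariant ::
    "nat \<Rightarrow> pep_data \<Rightarrow> (fvals \<Rightarrow> gram \<Rightarrow> bool) \<Rightarrow> (fvals \<Rightarrow> gram \<Rightarrow> real) \<Rightarrow> bool" where
  "permutation_invariant m D Init Perf \<longleftrightarrow>
     (\<forall>\<sigma> F G. \<sigma> permutes {..<m} \<longrightarrow> pep_feasible m D Init F G \<longrightarrow>
        pep_feasible m D Init (permF \<sigma> F) (permG \<sigma> G) \<and> Perf (permF \<sigma> F) (permG \<sigma> G) = Perf F G)"

lemma permutation_invariantD: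
  "permutation_invariant m D Init Perf \<Longrightarrow> \<sigma> permutes {..<m} \<Longrightarrow> pep_feasible m D Init F G \<Longrightarrow>
    pep_feasible m D Init (permF \<sigma> F) (permG \<sigma> G) \<and> Perf (permF \<sigma> F) (permG \<sigma> G) = Perf F G"
  unfolding permutation_invariant_def by blast

lemma agents_equivalent_permutation_invariant:
  assumes equiv: "agents_equivalent n D Init Perf"
  shows "permutation_invariant n D Init Perf"
proof -
  have "\<forall>F G. pep_feasible n D Init F G \<longrightarrow> pep_feasible n D Init (permF \<sigma> F) (permG \<sigma> G) \<and>
      Perf (permF \<sigma> F) (permG \<sigma> G) = Perf F G" if "\<sigma> permutes {..<n}" for \<sigma>
    using that finite_lessThan
  proof (induction rule: permutes_induct)
    case id
    then show ?case by (simp add: permF_def permG_def)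
  next
    case (swap a b \<tau>)
    show ?case
    proof (intro allI impI)
      fix F G assume "pep_feasible n D Init F G"
      then have "pep_feasible n D Init (swapF a b F) (swapG a b G)"
          "Perf (swapF a b F) (swapG a b G) = Perf F G"
        using equiv swap.hyps unfolding agents_equivalent_def by blast+
      moreover have "permF (transpose a b \<circ> \<tau>) F = permF \<tau> (swapF a b F)"
          "permG (transpose a b \<circ> \<tau>) G = permG \<tau> (swapG a b G)"
        by (simp_all add: permF_def permG_def swapF_def swapG_def fun_eq_iff)
      ultimately show "pep_feasible n D Init (permF (transpose a b \<circ> \<tau>) F) (permG (transpose a b \<circ> \<tau>) G)
          \<and> Perf (permF (transpose a b \<circ> \<tau>) F) (permG (transpose a b \<circ> \<tau>) G) = Perf F G"
        using swap.IH by simp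
    qed
  qed
  then show ?thesis unfolding permutation_invariant_def by blast
qed

section \<open>Symmetrization\<close>

definition perm_avgF :: "nat \<Rightarrow> fvals \<Rightarrow> fvals" where
  "perm_avgF m F = mixF {\<sigma>. \<sigma> permutes {..<m}} (\<lambda>_. 1 / fact m) (\<lambda>\<sigma>. permF \<sigma> F)"

definition perm_avgG :: "nat \<Rightarrow> gram \<Rightarrow> gram" where
  "perm_avgG m G = mixG {\<sigma>. \<sigma> permutes {..<m}} (\<lambda>_. 1 / fact m) (\<lambda>\<sigma>. permG \<sigma> G)"

lemma sum_uniform_permutations: "(\<Sum>\<sigma> | \<sigma> permutes {..<m}. 1 / fact m :: real) = 1"
  by (simp add: card_permutations)

lemma perm_avgF_permute:
  assumes "\<tau> permutes {..<m}"
  shows "perm_avgF m F (\<tau> i) = perm_avgF m F i"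
proof
  fix a
  show "perm_avgF m F (\<tau> i) a = perm_avgF m F i a"
    unfolding perm_avgF_def mixF_def permF_def
    using sum_permutations_compose_right[OF assms, of "\<lambda>\<sigma>. 1 / fact m * F (\<sigma> i) a"] by simp
qed

lemma perm_avgG_permute:
  assumes "\<tau> permutes {..<m}"
  shows "perm_avgG m G (\<tau> i) (\<tau> j) = perm_avgG m G i j"
proof (intro ext)
  fix a b
  show "perm_avgG m G (\<tau> i) (\<tau> j) a b = perm_avgG m G i j a b"
    unfolding perm_avgG_def mixG_def permG_def
    using sum_permutations_compose_right[OF assms, of "\<lambda>\<sigma>. 1 / fact m * G (\<sigma> i) (\<sigma> j) a b"]
    by simp
qed

lemma perm_avg_feasible:
  assumes inv: "permutation_invariant m D Init Perf"
    and Init: "local_convex m Init" and Perf: "local_affine m Perf"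
    and feasible: "pep_feasible m D Init F G"
  shows "pep_feasible m D Init (perm_avgF m F) (perm_avgG m G)"
    and "Perf (perm_avgF m F) (perm_avgG m G) = Perf F G"
proof -
  let ?S = "{\<sigma>. \<sigma> permutes {..<m}}" and ?w = "\<lambda>_. 1 / fact m :: real"
  have S: "finite ?S" by (simp add: finite_permutations)
  show "pep_feasible m D Init (perm_avgF m F) (perm_avgG m G)"
    unfolding perm_avgF_def perm_avgG_def
    using local_convex_mix[OF local_convex_pep_feasible[OF Init] S _ sum_uniform_permutations]
      permutation_invariantD[OF inv _ feasible]
    by simp
  have "Perf (perm_avgF m F) (perm_avgG m G) = (\<Sum>\<sigma>\<in>?S. ?w \<sigma> * Perf (permF \<sigma> F) (permG \<sigma> G))"
    unfolding perm_avgF_def perm_avgG_def by (rule local_affine_mix[OF Perf S sum_uniform_permutations])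
  also have "\<dots> = (\<Sum>\<sigma>\<in>?S. ?w \<sigma> * Perf F G)"
    using permutation_invariantD[OF inv _ feasible] by simp
  also have "\<dots> = Perf F G"
    by (simp only: sum_distrib_right[symmetric] sum_uniform_permutations)
  finally show "Perf (perm_avgF m F) (perm_avgG m G) = Perf F G" .
qed

lemma exists_permutes_pair:
  assumes "k \<noteq> l" "i \<noteq> j" "k < m" "l < m" "i < m" "j < m"
  obtains \<tau> where "\<tau> permutes {..<m}" "\<tau> k = i" "\<tau> l = j"
proof
  define l' where "l' = transpose k i l"
  have "l' < m" "l' \<noteq> i" using assms unfolding l'_def by (auto simp: transpose_def)
  then show "(transpose l' j \<circ> transpose k i) permutes {..<m}"
    by (intro permutes_compose permutes_swap_id) (use assms in auto)
  show "(transpose l' j \<circ> transpose k i) k = i"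
    using \<open>l' \<noteq> i\<close> assms by (auto simp: transpose_def)
  show "(transpose l' j \<circ> transpose k i) l = j"
    unfolding l'_def by (simp add: transpose_def)
qed

lemma agree_on_agents_symmetric:
  assumes m: "m \<ge> 2"
    and invF: "\<And>\<tau> i. \<tau> permutes {..<m} \<Longrightarrow> F (\<tau> i) = F i"
    and invG: "\<And>\<tau> i j. \<tau> permutes {..<m} \<Longrightarrow> G (\<tau> i) (\<tau> j) = G i j"
  shows "agree_on_agents m (symF (F 0)) (symG (G 0 0) (G 0 1)) F G"
  unfolding agree_on_agents_def
proof (intro conjI allI impI)
  fix i assume "i < m"
  then have "transpose 0 i permutes {..<m}" using m by (intro permutes_swap_id) auto
  then show "symF (F 0) i = F i" unfolding symF_def using invF[of "transpose 0 i" 0] by simp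
next
  fix i j assume i: "i < m" and j: "j < m"
  show "symG (G 0 0) (G 0 1) i j = G i j"
  proof (cases "i = j")
    case True
    from i m have "transpose 0 i permutes {..<m}" by (intro permutes_swap_id) auto
    then show ?thesis unfolding symG_def using True invG[of "transpose 0 i" 0 0] by simp
  next
    case False
    obtain \<tau> where "\<tau> permutes {..<m}" "\<tau> 0 = i" "\<tau> 1 = j"
      using exists_permutes_pair[of 0 1 i j m] False i j m by auto
    then show ?thesis unfolding symG_def using False invG[of \<tau> 0 1] by simp
  qed
qed

lemma exists_symmetric_solution:
  assumes m: "m \<ge> 2" and inv: "permutation_invariant m D Init Perf"
    and Init: "local_convex m Init" and Perf: "local_affine m Perf"
    and feasible: "pep_feasible m D Init F G"
  obtains fA GA GC where "pep_feasible m D Init (symF fA) (symG GA GC)"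
    and "Perf (symF fA) (symG GA GC) = Perf F G"
proof
  let ?F = "perm_avgF m F" and ?G = "perm_avgG m G"
  have agree: "agree_on_agents m (symF (?F 0)) (symG (?G 0 0) (?G 0 1)) ?F ?G"
    using m perm_avgF_permute perm_avgG_permute by (rule agree_on_agents_symmetric)
  show "pep_feasible m D Init (symF (?F 0)) (symG (?G 0 0) (?G 0 1))"
    using perm_avg_feasible(1)[OF inv Init Perf feasible]
      local_convex_agree[OF local_convex_pep_feasible[OF Init] agree] by simp
  show "Perf (symF (?F 0)) (symG (?G 0 0) (?G 0 1)) = Perf F G"
    using perm_avg_feasible(2)[OF inv Init Perf feasible] local_affine_agree[OF Perf agree] by simp
qed

lemma pep_value_eq_reduced_value:
  assumes m: "m \<ge> 2" and inv: "permutation_invariant m D Init Perf"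
    and Init: "local_convex m Init" and Perf: "local_affine m Perf"
  shows "pep_value m D Init Perf = reduced_value m D Init Perf"
  unfolding pep_value_def reduced_value_def
proof (rule SUP_eq)
  fix FG assume "FG \<in> {(F, G). pep_feasible m D Init F G}"
  then obtain fA GA GC where "pep_feasible m D Init (symF fA) (symG GA GC)"
      "Perf (symF fA) (symG GA GC) = Perf (fst FG) (snd FG)"
    using exists_symmetric_solution[OF m inv Init Perf] by force
  then show "\<exists>X\<in>{(fA, GA, GC). pep_feasible m D Init (symF fA) (symG GA GC)}.
      ereal (Perf (fst FG) (snd FG)) \<le> ereal (Perf (symF (fst X)) (symG (fst (snd X)) (snd (snd X))))"
    by (intro bexI[of _ "(fA, GA, GC)"]) auto
next
  fix X assume "X \<in> {(fA, GA, GC). pep_feasible m D Init (symF fA) (symG GA GC)}"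
  then show "\<exists>FG\<in>{(F, G). pep_feasible m D Init F G}.
      ereal (Perf (symF (fst X)) (symG (fst (snd X)) (snd (snd X)))) \<le> ereal (Perf (fst FG) (snd FG))"
    by (intro bexI[of _ "(symF (fst X), symG (fst (snd X)) (snd (snd X)))"]) auto
qed

section \<open>Positive semidefiniteness of symmetric Gram matrices\<close>

definition bform :: "nat \<Rightarrow> (nat \<Rightarrow> nat \<Rightarrow> real) \<Rightarrow> (nat \<Rightarrow> real) \<Rightarrow> (nat \<Rightarrow> real) \<Rightarrow> real" where
  "bform p M x y = (\<Sum>a<p. \<Sum>b<p. x a * M a b * y b)"

lemma psd_mat_iff_bform:
  "psd_mat p M \<longleftrightarrow> (\<forall>a<p. \<forall>b<p. M a b = M b a) \<and> (\<forall>x. 0 \<le> bform p M x x)"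
  unfolding psd_mat_def bform_def ..

lemma bform_sum_left: "bform p M (\<lambda>a. \<Sum>i\<in>I. x i a) y = (\<Sum>i\<in>I. bform p M (x i) y)"
  unfolding bform_def sum_distrib_right by (rule sum_swap_innermost2)

lemma bform_sum_right: "bform p M y (\<lambda>a. \<Sum>i\<in>I. x i a) = (\<Sum>i\<in>I. bform p M y (x i))"
  unfolding bform_def sum_distrib_left by (rule sum_swap_innermost2)

lemma bform_scale_left: "bform p M (\<lambda>a. c * x a) y = c * bform p M x y"
  unfolding bform_def by (simp add: sum_distrib_left mult_ac)

lemma bform_scale_right: "bform p M y (\<lambda>a. c * x a) = c * bform p M y x"
  unfolding bform_def by (simp add: sum_distrib_left mult_ac)

lemma bform_diff_left: "bform p M (\<lambda>a. x a - z a) y = bform p M x y - bform p M z y"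
  unfolding bform_def by (simp add: left_diff_distrib sum_subtractf)

lemma bform_diff_right: "bform p M y (\<lambda>a. x a - z a) = bform p M y x - bform p M y z"
  unfolding bform_def by (simp add: right_diff_distrib sum_subtractf)

lemma bform_uminus_left: "bform p M (\<lambda>a. - x a) y = - bform p M x y"
  unfolding bform_def by (simp add: sum_negf)

lemma bform_uminus_right: "bform p M y (\<lambda>a. - x a) = - bform p M y x"
  unfolding bform_def by (simp add: sum_negf)

lemma bform_zero_left: "bform p M (\<lambda>a. 0) y = 0"
  unfolding bform_def by simp

lemma bform_add_scale_mat: "bform p (\<lambda>a b. M a b + c * N a b) x y = bform p M x y + c * bform p N x y"
  unfolding bform_def by (simp add: distrib_left distrib_right sum.distrib sum_distrib_left mult_ac)

lemma bform_diff_mat: "bform p (\<lambda>a b. M a b - N a b) x y = bform p M x y - bform p N x y"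
  unfolding bform_def by (simp add: right_diff_distrib left_diff_distrib sum_subtractf)

lemma quadratic_form_symG:
  "(\<Sum>i<n. \<Sum>j<n. \<Sum>a<p. \<Sum>b<p. v i a * symG GA GC i j a b * v j b)
   = (\<Sum>i<n. bform p (\<lambda>a b. GA a b - GC a b) (v i) (v i))
     + bform p GC (\<lambda>a. \<Sum>i<n. v i a) (\<lambda>a. \<Sum>i<n. v i a)"
proof -
  have "(\<Sum>a<p. \<Sum>b<p. v i a * symG GA GC i j a b * v j b)
      = (if i = j then bform p (\<lambda>a b. GA a b - GC a b) (v i) (v j) else 0) + bform p GC (v i) (v j)"
    for i j
    by (cases "i = j") (simp_all add: symG_def bform_diff_mat, simp_all add: bform_def)
  then show ?thesis
    by (simp add: sum.distrib bform_sum_left bform_sum_right)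
qed

lemma sum_lessThan_two_nonzero:
  assumes "(n::nat) \<ge> 2" "\<And>i. 2 \<le> i \<Longrightarrow> g i = 0"
  shows "(\<Sum>i<n. g i) = g 0 + (g 1 :: real)"
proof -
  have "(\<Sum>i<n. g i) = (\<Sum>i\<in>{0,1}. g i)"
    by (rule sum.mono_neutral_right) (use assms in auto)
  then show ?thesis by simp
qed

lemma psd_gram_symG_symmetric:
  assumes n: "n \<ge> 2" and G: "psd_gram n p (symG GA GC)" and ab: "a < p" "b < p"
  shows "GA a b = GA b a" and "GC a b = GC b a"
proof -
  have "symG GA GC i j a b = symG GA GC j i b a" if "i < n" "j < n" for i j
    using G that ab unfolding psd_gram_def by blast
  from this[of 0 0] this[of 0 1] n show "GA a b = GA b a" "GC a b = GC b a"
    by (simp_all add: symG_def)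
qed

lemma psd_gram_symG_imp_psd_mat:
  assumes n: "n \<ge> 2" and G: "psd_gram n p (symG GA GC)"
  shows "psd_mat p (\<lambda>a b. GA a b - GC a b)"
    and "psd_mat p (\<lambda>a b. GA a b + (real n - 1) * GC a b)"
proof -
  have Q: "0 \<le> (\<Sum>i<n. bform p (\<lambda>a b. GA a b - GC a b) (v i) (v i))
      + bform p GC (\<lambda>a. \<Sum>i<n. v i a) (\<lambda>a. \<Sum>i<n. v i a)" for v
    using G unfolding psd_gram_def quadratic_form_symG[symmetric] by blast
  note sym = psd_gram_symG_symmetric[OF n G]
  show "psd_mat p (\<lambda>a b. GA a b - GC a b)"
    unfolding psd_mat_iff_bform
  proof (intro conjI allI impI)
    fix x :: "nat \<Rightarrow> real"
    let ?v = "\<lambda>i::nat. if i = 0 then x else if i = 1 then (\<lambda>a. - x a) else (\<lambda>a. 0)"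
    have "(\<Sum>i<n. ?v i a) = 0" for a
      by (subst sum_lessThan_two_nonzero[OF n]) auto
    moreover have "(\<Sum>i<n. bform p (\<lambda>a b. GA a b - GC a b) (?v i) (?v i))
        = 2 * bform p (\<lambda>a b. GA a b - GC a b) x x"
      by (subst sum_lessThan_two_nonzero[OF n]) (auto simp: bform_uminus_left bform_uminus_right bform_zero_left)
    ultimately show "0 \<le> bform p (\<lambda>a b. GA a b - GC a b) x x"
      using Q[of ?v] by (simp add: bform_zero_left)
  qed (simp add: sym)
  show "psd_mat p (\<lambda>a b. GA a b + (real n - 1) * GC a b)"
    unfolding psd_mat_iff_bform
  proof (intro conjI allI impI)
    fix x :: "nat \<Rightarrow> real"
    have "0 \<le> real n * bform p (\<lambda>a b. GA a b - GC a b) x x + bform p GC (\<lambda>a. real n * x a) (\<lambda>a. real n * x a)"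
      using Q[of "\<lambda>_. x"] by simp
    also have "\<dots> = real n * bform p (\<lambda>a b. GA a b + (real n - 1) * GC a b) x x"
      by (simp add: bform_scale_left bform_scale_right bform_add_scale_mat bform_diff_mat algebra_simps)
    finally show "0 \<le> bform p (\<lambda>a b. GA a b + (real n - 1) * GC a b) x x"
      using n by (simp add: zero_le_mult_iff)
  qed (simp add: sym)
qed

lemma bform_mean_le:
  fixes v :: "nat \<Rightarrow> nat \<Rightarrow> real"
  assumes M: "psd_mat p M" and n: "n > 0"
  defines "u \<equiv> \<lambda>a. (\<Sum>i<n. v i a) / real n"
  shows "real n * bform p M u u \<le> (\<Sum>i<n. bform p M (v i) (v i))"
proof -
  have sum_v: "(\<lambda>a. \<Sum>i<n. v i a) = (\<lambda>a. real n * u a)"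
    using n unfolding u_def by auto
  have cross: "(\<Sum>i<n. bform p M (v i) u) = real n * bform p M u u"
      "(\<Sum>i<n. bform p M u (v i)) = real n * bform p M u u"
    by (simp_all add: bform_sum_left[symmetric] bform_sum_right[symmetric] sum_v
        bform_scale_left bform_scale_right)
  have "0 \<le> (\<Sum>i<n. bform p M (\<lambda>a. v i a - u a) (\<lambda>a. v i a - u a))"
    using M by (intro sum_nonneg) (simp add: psd_mat_iff_bform)
  also have "\<dots> = (\<Sum>i<n. bform p M (v i) (v i)) - real n * bform p M u u"
    by (simp add: bform_diff_left bform_diff_right sum.distrib sum_subtractf cross)
  finally show ?thesis by simp
qed

lemma psd_mat_imp_psd_gram_symG:
  assumes n: "n \<ge> 2"
    and disagreement: "psd_mat p (\<lambda>a b. GA a b - GC a b)"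
    and consensus: "psd_mat p (\<lambda>a b. GA a b + (real n - 1) * GC a b)"
  shows "psd_gram n p (symG GA GC)"
  unfolding psd_gram_def
proof (intro conjI allI impI)
  have "GA a b = GA b a \<and> GC a b = GC b a" if "a < p" "b < p" for a b
  proof -
    have "GA a b - GC a b = GA b a - GC b a"
        "GA a b + real n * GC a b - GC a b = GA b a + real n * GC b a - GC b a"
      using disagreement consensus that unfolding psd_mat_def by (auto simp: algebra_simps)
    then have "real n * GC a b = real n * GC b a" by linarith
    with n \<open>GA a b - GC a b = GA b a - GC b a\<close> show ?thesis by simp
  qed
  then show "symG GA GC i j a b = symG GA GC j i b a" if "a < p" "b < p" for i j a b
    using that by (simp add: symG_def)
next
  fix v :: "nat \<Rightarrow> nat \<Rightarrow> real"
  define u where "u = (\<lambda>a. (\<Sum>i<n. v i a) / real n)"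
  have sum_v: "(\<lambda>a. \<Sum>i<n. v i a) = (\<lambda>a. real n * u a)"
    using n unfolding u_def by auto
  have "0 \<le> real n * bform p (\<lambda>a b. GA a b + (real n - 1) * GC a b) u u"
    using consensus by (simp add: psd_mat_iff_bform)
  also have "\<dots> = real n * bform p (\<lambda>a b. GA a b - GC a b) u u + bform p GC (\<lambda>a. real n * u a) (\<lambda>a. real n * u a)"
    by (simp add: bform_scale_left bform_scale_right bform_add_scale_mat bform_diff_mat algebra_simps)
  also have "\<dots> \<le> (\<Sum>i<n. \<Sum>j<n. \<Sum>a<p. \<Sum>b<p. v i a * symG GA GC i j a b * v j b)"
    unfolding quadratic_form_symG sum_v[symmetric]
    using bform_mean_le[OF disagreement, of n v] n by (simp add: u_def)
  finally show "0 \<le> (\<Sum>i<n. \<Sum>j<n. \<Sum>a<p. \<Sum>b<p. v i a * symG GA GC i j a b * v j b)" .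
qed

lemma psd_gram_symG_iff:
  "n \<ge> 2 \<Longrightarrow> psd_gram n p (symG GA GC) \<longleftrightarrow>
     psd_mat p (\<lambda>a b. GA a b - GC a b) \<and> psd_mat p (\<lambda>a b. GA a b + (real n - 1) * GC a b)"
  using psd_gram_symG_imp_psd_mat psd_mat_imp_psd_gram_symG by blast

section \<open>The reduced SDP\<close>

definition avg_block :: "nat \<Rightarrow> (nat \<Rightarrow> nat \<Rightarrow> real) \<Rightarrow> (nat \<Rightarrow> nat \<Rightarrow> real) \<Rightarrow> nat \<Rightarrow> nat \<Rightarrow> real" where
  "avg_block m GA GC = (\<lambda>a b. (GA a b + (real m - 1) * GC a b) / real m)"

lemma avg_block_inverse:
  "m \<ge> 2 \<Longrightarrow> avg_block m GA (\<lambda>a b. (real m * GM a b - GA a b) / (real m - 1)) = GM"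
  by (simp add: avg_block_def fun_eq_iff field_simps)

lemma sum_symG:
  "(\<Sum>i<m. \<Sum>j<m. symG GA GC i j a b) = real m * (GA a b + (real m - 1) * GC a b)"
proof -
  have "(\<Sum>j<m. symG GA GC i j a b) = GA a b + (real m - 1) * GC a b" if "i < m" for i
  proof -
    have "(\<Sum>j<m. symG GA GC i j a b) = (\<Sum>j<m. GC a b + (if i = j then GA a b - GC a b else 0))"
      by (intro sum.cong) (auto simp: symG_def)
    with that show ?thesis by (simp add: sum.distrib algebra_simps)
  qed
  then show ?thesis by simp
qed

lemma avg_inner_symG: "m > 0 \<Longrightarrow> avg_inner m (symG GA GC) a b = avg_block m GA GC a b"
  unfolding avg_inner_def avg_block_def sum_symG by (simp add: power2_eq_square)

lemma perpG_symG:
  "m > 0 \<Longrightarrow> perpG m (symG GA GC) a b = real m * (GA a b - avg_block m GA GC a b)"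
  unfolding perpG_def avg_block_def sum_symG by (simp add: symG_def field_simps)

lemma avgF_symF: "m > 0 \<Longrightarrow> avgF m (symF fA) a = fA a"
  unfolding avgF_def symF_def by simp

lemma avgD_symG: "m > 0 \<Longrightarrow> avgD m (symG GA GC) a b = GA a b"
  unfolding avgD_def by (simp add: symG_def)

definition si_eval_reduced ::
    "nat \<Rightarrow> nat \<Rightarrow> si_expr \<Rightarrow> (nat \<Rightarrow> real) \<Rightarrow> (nat \<Rightarrow> nat \<Rightarrow> real) \<Rightarrow> (nat \<Rightarrow> nat \<Rightarrow> real) \<Rightarrow> real" where
  "si_eval_reduced p q e fA GA GM = si_c0 e + (\<Sum>a<q. si_cf e a * fA a)
      + (\<Sum>a<p. \<Sum>b<p. si_cA e a b * GA a b) + (\<Sum>a<p. \<Sum>b<p. si_cC e a b * GM a b)"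

lemma si_eval_symmetric:
  "m > 0 \<Longrightarrow> si_eval m p q e (symF fA) (symG GA GC) = si_eval_reduced p q e fA GA (avg_block m GA GC)"
  unfolding si_eval_def si_eval_reduced_def by (simp add: avgF_symF avgD_symG avg_inner_symG)

definition consensus_reduced ::
    "real \<Rightarrow> real \<Rightarrow> nat list \<times> nat list \<Rightarrow> (nat \<Rightarrow> nat \<Rightarrow> real) \<Rightarrow> (nat \<Rightarrow> nat \<Rightarrow> real) \<Rightarrow> bool" where
  "consensus_reduced lm lp blk GA GM \<longleftrightarrow>
     (let xs = fst blk; ys = snd blk; K = length xs; P = (\<lambda>a b. GA a b - GM a b) in
       (\<forall>k<K. GM (xs!k) (xs!k) - 2 * GM (xs!k) (ys!k) + GM (ys!k) (ys!k) = 0) \<and>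
       (\<forall>k<K. \<forall>l<K. P (xs!k) (ys!l) = P (ys!k) (xs!l)) \<and>
       psd_mat K (\<lambda>k l. - (P (ys!k) (ys!l) - lp * P (ys!k) (xs!l)
                          - lm * P (xs!k) (ys!l) + lm * lp * P (xs!k) (xs!l))))"

lemma consensus_holds_symG:
  assumes "m > 0"
  shows "consensus_holds m lm lp blk (symG GA GC) \<longleftrightarrow> consensus_reduced lm lp blk GA (avg_block m GA GC)"
proof -
  let ?P = "\<lambda>a b. GA a b - avg_block m GA GC a b"
  let ?S = "\<lambda>K xs ys k l. - (?P (ys!k) (ys!l) - lp * ?P (ys!k) (xs!l)
          - lm * ?P (xs!k) (ys!l) + lm * lp * ?P (xs!k) (xs!l))"
  have scale: "psd_mat K (\<lambda>k l. - (real m * ?P (ys!k) (ys!l) - lp * (real m * ?P (ys!k) (xs!l))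
          - lm * (real m * ?P (xs!k) (ys!l)) + lm * lp * (real m * ?P (xs!k) (xs!l))))
      \<longleftrightarrow> psd_mat K (?S K xs ys)" for K xs ys
  proof -
    have "psd_mat K (\<lambda>k l. - (real m * ?P (ys!k) (ys!l) - lp * (real m * ?P (ys!k) (xs!l))
          - lm * (real m * ?P (xs!k) (ys!l)) + lm * lp * (real m * ?P (xs!k) (xs!l))))
        \<longleftrightarrow> psd_mat K (\<lambda>k l. real m * ?S K xs ys k l)"
      by (rule psd_mat_cong) (simp add: algebra_simps)
    also have "\<dots> \<longleftrightarrow> psd_mat K (?S K xs ys)"
      using assms by (simp add: psd_mat_scale_iff)
    finally show ?thesis .
  qed
  from assms show ?thesis
    unfolding consensus_holds_def consensus_reduced_def Let_def perpG_symG[OF assms] avg_inner_symG[OF assms] scale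
    by simp
qed

lemma psd_gram_symG_iff_avg_block:
  assumes m: "m \<ge> 2"
  shows "psd_gram m p (symG GA GC) \<longleftrightarrow>
     psd_mat p (\<lambda>a b. GA a b - avg_block m GA GC a b) \<and> psd_mat p (avg_block m GA GC)"
proof -
  have "psd_mat p (\<lambda>a b. GA a b - GC a b)
      \<longleftrightarrow> psd_mat p (\<lambda>a b. real m / (real m - 1) * (GA a b - avg_block m GA GC a b))"
    by (rule psd_mat_cong) (use m in \<open>simp add: avg_block_def field_simps\<close>)
  also have "\<dots> \<longleftrightarrow> psd_mat p (\<lambda>a b. GA a b - avg_block m GA GC a b)"
    by (rule psd_mat_scale_iff) (use m in simp)
  finally have disagreement: "psd_mat p (\<lambda>a b. GA a b - GC a b)
      \<longleftrightarrow> psd_mat p (\<lambda>a b. GA a b - avg_block m GA GC a b)" .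
  have "psd_mat p (\<lambda>a b. GA a b + (real m - 1) * GC a b)
      \<longleftrightarrow> psd_mat p (\<lambda>a b. real m * avg_block m GA GC a b)"
    by (rule psd_mat_cong) (use m in \<open>simp add: avg_block_def field_simps\<close>)
  also have "\<dots> \<longleftrightarrow> psd_mat p (avg_block m GA GC)"
    by (rule psd_mat_scale_iff) (use m in simp)
  finally show ?thesis by (simp add: psd_gram_symG_iff[OF m] disagreement)
qed

lemma common_point_symG:
  assumes m: "m \<ge> 2"
  shows "(\<forall>i<m. \<forall>j<m. symG GA GC i i c c - 2 * symG GA GC i j c c + symG GA GC j j c c = 0)
     \<longleftrightarrow> GA c c = avg_block m GA GC c c"
proof -
  have "GA c c - avg_block m GA GC c c = (real m - 1) / real m * (GA c c - GC c c)"
    using m by (simp add: avg_block_def field_simps)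
  moreover have "(\<forall>i<m. \<forall>j<m. symG GA GC i i c c - 2 * symG GA GC i j c c + symG GA GC j j c c = 0)
      \<longleftrightarrow> GA c c = GC c c"
  proof
    assume "\<forall>i<m. \<forall>j<m. symG GA GC i i c c - 2 * symG GA GC i j c c + symG GA GC j j c c = 0"
    from this[rule_format, of 0 1] m show "GA c c = GC c c" by (simp add: symG_def)
  qed (simp add: symG_def)
  ultimately show ?thesis using m by auto
qed

lemma sa_holds_symmetric:
  "sa_holds p q c (symF fA) (symG GA GC) i = sa_holds p q c (\<lambda>_. fA) (\<lambda>_ _. GA) 0"
  unfolding sa_holds_def sa_eval_def by (simp add: symF_def symG_def)

lemma si_holds_symmetric:
  "m > 0 \<Longrightarrow> si_holds m p q c (symF fA) (symG GA GC) \<longleftrightarrow>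
    psd_mat (fst c) (\<lambda>k l. si_eval_reduced p q (snd c k l) fA GA (avg_block m GA GC))"
  unfolding si_holds_def by (simp add: si_eval_symmetric)

definition sa_si_holds ::
    "nat \<Rightarrow> nat \<Rightarrow> nat \<Rightarrow> sa_lmi list \<Rightarrow> si_lmi list \<Rightarrow> fvals \<Rightarrow> gram \<Rightarrow> bool" where
  "sa_si_holds m p q ISA ISI F G \<longleftrightarrow>
     (\<forall>i<m. \<forall>c \<in> set ISA. sa_holds p q c F G i) \<and> (\<forall>c \<in> set ISI. si_holds m p q c F G)"

lemma local_convex_sa_si_holds: "local_convex m (sa_si_holds m p q ISA ISI)"
  unfolding sa_si_holds_def
  by (intro local_convex_conj local_convex_all local_convex_imp local_convex_ball
      local_convex_sa_holds local_convex_si_holds)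

lemma permutation_invariant_sa_si:
  "permutation_invariant m D (sa_si_holds m (pd_p D) (pd_q D) ISA ISI) (si_eval m (pd_p D) (pd_q D) P)"
  unfolding permutation_invariant_def
proof (intro allI impI conjI)
  fix \<sigma> F G assume \<sigma>: "\<sigma> permutes {..<m}"
  have "sa_si_holds m (pd_p D) (pd_q D) ISA ISI (permF \<sigma> F) (permG \<sigma> G)"
    if "sa_si_holds m (pd_p D) (pd_q D) ISA ISI F G" for F G
    using that permutes_in_image[OF \<sigma>]
    by (simp add: sa_si_holds_def sa_holds_permute si_holds_permute[OF \<sigma>])
  from \<sigma> this show "pep_feasible m D (sa_si_holds m (pd_p D) (pd_q D) ISA ISI) (permF \<sigma> F) (permG \<sigma> G)"
    if "pep_feasible m D (sa_si_holds m (pd_p D) (pd_q D) ISA ISI) F G"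
    using that by (rule pep_feasible_permute)
  show "si_eval m (pd_p D) (pd_q D) P (permF \<sigma> F) (permG \<sigma> G) = si_eval m (pd_p D) (pd_q D) P F G"
    by (rule si_eval_permute[OF \<sigma>])
qed

text \<open>The n-independent SDP in (f^A, G^A, G^M), where G^M is the Gram block of the agent
  average.  Single-agent constraints read only the block (i, i), so they are evaluated on the
  constant point (f^A, G^A) at agent 0.\<close>

definition reduced_feasible :: "pep_data \<Rightarrow> sa_lmi list \<Rightarrow> si_lmi list
    \<Rightarrow> (nat \<Rightarrow> real) \<Rightarrow> (nat \<Rightarrow> nat \<Rightarrow> real) \<Rightarrow> (nat \<Rightarrow> nat \<Rightarrow> real) \<Rightarrow> bool" where
  "reduced_feasible D ISA ISI fA GA GM \<longleftrightarrow>
     psd_mat (pd_p D) (\<lambda>a b. GA a b - GM a b) \<and> psd_mat (pd_p D) GM \<and>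
     (\<forall>c \<in> set (pd_local D). sa_holds (pd_p D) (pd_q D) c (\<lambda>_. fA) (\<lambda>_ _. GA) 0) \<and>
     (\<forall>c \<in> set (pd_common D). GA c c = GM c c) \<and>
     GM (pd_gopt D) (pd_gopt D) = 0 \<and>
     (\<forall>blk \<in> set (pd_cons D). consensus_reduced (pd_lmin D) (pd_lmax D) blk GA GM) \<and>
     (\<forall>c \<in> set ISA. sa_holds (pd_p D) (pd_q D) c (\<lambda>_. fA) (\<lambda>_ _. GA) 0) \<and>
     (\<forall>c \<in> set ISI. psd_mat (fst c) (\<lambda>k l. si_eval_reduced (pd_p D) (pd_q D) (snd c k l) fA GA GM))"

lemma pep_feasible_symmetric_iff:
  assumes m: "m \<ge> 2"
  shows "pep_feasible m D (sa_si_holds m (pd_p D) (pd_q D) ISA ISI) (symF fA) (symG GA GC)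
    \<longleftrightarrow> reduced_feasible D ISA ISI fA GA (avg_block m GA GC)"
proof -
  have m0: "m > 0" using m by simp
  have "(\<forall>i<m. X) \<longleftrightarrow> X" for X using m0 by blast
  then show ?thesis
    unfolding pep_feasible_def reduced_feasible_def sa_si_holds_def
    by (simp only: psd_gram_symG_iff_avg_block[OF m] sa_holds_symmetric common_point_symG[OF m]
        avg_inner_symG[OF m0] consensus_holds_symG[OF m0] si_holds_symmetric[OF m0] conj_assoc)
qed

lemma reduced_set_sa_si:
  assumes m: "m \<ge> 2"
  shows "reduced_set m D (sa_si_holds m (pd_p D) (pd_q D) ISA ISI)
    = {(fA, GA, GM). reduced_feasible D ISA ISI fA GA GM}"
proof (intro set_eqI iffI)
  fix X assume "X \<in> reduced_set m D (sa_si_holds m (pd_p D) (pd_q D) ISA ISI)"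
  then show "X \<in> {(fA, GA, GM). reduced_feasible D ISA ISI fA GA GM}"
    unfolding reduced_set_def avg_block_def[symmetric] by (auto simp: pep_feasible_symmetric_iff[OF m])
next
  fix X assume "X \<in> {(fA, GA, GM). reduced_feasible D ISA ISI fA GA GM}"
  then obtain fA GA GM where X: "X = (fA, GA, GM)" and feasible: "reduced_feasible D ISA ISI fA GA GM"
    by auto
  define GC where "GC = (\<lambda>a b. (real m * GM a b - GA a b) / (real m - 1))"
  have "avg_block m GA GC = GM" unfolding GC_def by (rule avg_block_inverse[OF m])
  with X feasible show "X \<in> reduced_set m D (sa_si_holds m (pd_p D) (pd_q D) ISA ISI)"
    unfolding reduced_set_def avg_block_def[symmetric]
    by (auto simp: pep_feasible_symmetric_iff[OF m])
qed

lemma reduced_value_eq_SUP_reduced_set: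
  assumes "m > 0"
  shows "reduced_value m D Init (si_eval m (pd_p D) (pd_q D) P)
    = (SUP X \<in> reduced_set m D Init. ereal (si_eval_reduced (pd_p D) (pd_q D) P (fst X) (fst (snd X)) (snd (snd X))))"
proof -
  have "reduced_set m D Init = (\<lambda>(fA, GA, GC). (fA, GA, avg_block m GA GC))
      ` {(fA, GA, GC). pep_feasible m D Init (symF fA) (symG GA GC)}"
    unfolding reduced_set_def avg_block_def by (force simp: image_iff)
  then show ?thesis
    unfolding reduced_value_def by (simp add: image_comp si_eval_symmetric[OF assms] case_prod_beta)
qed

lemma pep_value_sa_si:
  assumes m: "m \<ge> 2"
  shows "pep_value m D (sa_si_holds m (pd_p D) (pd_q D) ISA ISI) (si_eval m (pd_p D) (pd_q D) P)
    = (SUP X \<in> {(fA, GA, GM). reduced_feasible D ISA ISI fA GA GM}.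
        ereal (si_eval_reduced (pd_p D) (pd_q D) P (fst X) (fst (snd X)) (snd (snd X))))"
  using pep_value_eq_reduced_value[OF m permutation_invariant_sa_si local_convex_sa_si_holds
      local_affine_si_eval] reduced_value_eq_SUP_reduced_set reduced_set_sa_si[OF m] m
  by simp

theorem theorem3:
  fixes n :: nat and D :: pep_data
    and Init :: "nat \<Rightarrow> fvals \<Rightarrow> gram \<Rightarrow> bool"
    and Perf :: "nat \<Rightarrow> fvals \<Rightarrow> gram \<Rightarrow> real"
  assumes n2: "n \<ge> 2"
    and lam: "-1 < pd_lmin D" "pd_lmin D \<le> pd_lmax D" "pd_lmax D < 1"
    and wf: "pep_wf D"
    and init_repr: "lmi_representable n (pd_p D) (pd_q D) (Init n)"
    and perf_lin: "gram_affine n (pd_p D) (pd_q D) (Perf n)"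
    and equiv: "agents_equivalent n D (Init n) (Perf n)"
  shows
    "(\<forall>GA GC. psd_gram n (pd_p D) (symG GA GC) \<longleftrightarrow>
         psd_mat (pd_p D) (\<lambda>a b. GA a b - GC a b) \<and>
         psd_mat (pd_p D) (\<lambda>a b. GA a b + (real n - 1) * GC a b))
     \<and> pep_value n D (Init n) (Perf n) = reduced_value n D (Init n) (Perf n)
     \<and> ((\<exists>(ISA :: sa_lmi list) (ISI :: si_lmi list) (P :: si_expr).
            (\<forall>m\<ge>2. \<forall>F G. Init m F G \<longleftrightarrow>
               (\<forall>i<m. \<forall>c \<in> set ISA. sa_holds (pd_p D) (pd_q D) c F G i) \<and>
               (\<forall>c \<in> set ISI. si_holds m (pd_p D) (pd_q D) c F G)) \<and>
            (\<forall>m\<ge>2. \<forall>F G. Perf m F G = si_eval m (pd_p D) (pd_q D) P F G))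
         \<longrightarrow> (\<forall>m\<ge>2. reduced_set m D (Init m) = reduced_set n D (Init n) \<and>
                     pep_value m D (Init m) (Perf m) = pep_value n D (Init n) (Perf n)))"
proof -
  have reduction: "pep_value n D (Init n) (Perf n) = reduced_value n D (Init n) (Perf n)"
    using n2 agents_equivalent_permutation_invariant[OF equiv]
      local_convex_lmi_representable[OF init_repr] local_affine_gram_affine[OF perf_lin]
    by (rule pep_value_eq_reduced_value)
  have independence: "reduced_set m D (Init m) = reduced_set n D (Init n) \<and>
      pep_value m D (Init m) (Perf m) = pep_value n D (Init n) (Perf n)"
    if Init: "\<forall>m\<ge>2. \<forall>F G. Init m F G \<longleftrightarrow> sa_si_holds m (pd_p D) (pd_q D) ISA ISI F G"
      and Perf: "\<forall>m\<ge>2. \<forall>F G. Perf m F G = si_eval m (pd_p D) (pd_q D) P F G"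
      and m: "m \<ge> 2" for ISA ISI P m
  proof -
    have "Init k = sa_si_holds k (pd_p D) (pd_q D) ISA ISI" "Perf k = si_eval k (pd_p D) (pd_q D) P"
      if "k \<ge> 2" for k
      using Init Perf that by (simp_all add: fun_eq_iff)
    with m n2 show ?thesis by (simp add: reduced_set_sa_si pep_value_sa_si)
  qed
  show ?thesis
    unfolding sa_si_holds_def[symmetric]
    using psd_gram_symG_iff[OF n2] reduction independence by blast
qed

end
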